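(* Let $A$ be a finite set with at least two elements, let $e \ge 1$, and let $(B;+)$ be an abelian group of exponent $2^e$. Then for every $n \ge 1$, every function $f \colon A^n \to B$ determined by $\operatorname{oddsupp}$ is $(|A| + e - 2)$-decomposable.
   Context: For a tuple $(a_1,\dots,a_m) \in A^m$, $\operatorname{oddsupp}(a_1,\dots,a_m) = \{a \in A : |\{j : a_j = a\}| \text{ is odd}\}$. A function $f \colon A^n \to B$ is determined by $\operatorname{oddsupp}$ if there is a map $\varphi \colon \mathcal{P}(A) \to B$ with $f(\mathbf{x}) = \varphi(\operatorname{oddsupp}(\mathbf{x}))$ for all $\mathbf{x} \in A^n$. The $i$-th variable of $g \colon A^n \to B$ is essential if there are tuples differing only in the $i$-th coordinate on which $g$ takes different values; the essential arity of $g$ is the number of its essential variables. $f$ is $k$-decomposable if $f = f_1 + \dots + f_s$ for some functions $f_j \colon A^n \to B$ each of essential arity at most $k$. The exponent of $B$ is the least common multiple of the orders of its elements (if these are bounded). *)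

theory Defs
  imports "HOL-Algebra.Multiplicative_Group" "HOL-Library.FuncSet"
begin

(* Abelian groups are the multiplicatively written comm_group of HOL-Algebra, so the sum
   f_1 + ... + f_s of functions into B is the pointwise finprod in B. *)

(* 0 iff the orders are unbounded or some element has infinite order: group.ord is 0 for
   elements of infinite order, and Lcm on nat is 0 for infinite sets and sets containing 0. *)
definition group_exponent :: "('b, 'm) monoid_scheme \<Rightarrow> nat" where
  "group_exponent G = Lcm (group.ord G ` carrier G)"

(* A^n, with coordinates 1, ..., n *)
definition tuples :: "nat \<Rightarrow> 'a set \<Rightarrow> (nat \<Rightarrow> 'a) set" where
  "tuples n A = ({1..n} \<rightarrow>\<^sub>E A)"

definition oddsupp :: "nat \<Rightarrow> 'a set \<Rightarrow> (nat \<Rightarrow> 'a) \<Rightarrow> 'a set" where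
  "oddsupp n A x = {a \<in> A. odd (card {j \<in> {1..n}. x j = a})}"

definition determined_by_oddsupp ::
    "nat \<Rightarrow> 'a set \<Rightarrow> 'b set \<Rightarrow> ((nat \<Rightarrow> 'a) \<Rightarrow> 'b) \<Rightarrow> bool" where
  "determined_by_oddsupp n A B f \<longleftrightarrow>
     (\<exists>\<phi> \<in> Pow A \<rightarrow> B. \<forall>x \<in> tuples n A. f x = \<phi> (oddsupp n A x))"

definition essential :: "nat \<Rightarrow> 'a set \<Rightarrow> ((nat \<Rightarrow> 'a) \<Rightarrow> 'b) \<Rightarrow> nat \<Rightarrow> bool" where
  "essential n A g i \<longleftrightarrow>
     (\<exists>x \<in> tuples n A. \<exists>y \<in> tuples n A. (\<forall>j \<in> {1..n} - {i}. x j = y j) \<and> g x \<noteq> g y)"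

definition essential_arity :: "nat \<Rightarrow> 'a set \<Rightarrow> ((nat \<Rightarrow> 'a) \<Rightarrow> 'b) \<Rightarrow> nat" where
  "essential_arity n A g = card {i \<in> {1..n}. essential n A g i}"

definition decomposable ::
    "nat \<Rightarrow> nat \<Rightarrow> 'a set \<Rightarrow> ('b, 'm) monoid_scheme \<Rightarrow> ((nat \<Rightarrow> 'a) \<Rightarrow> 'b) \<Rightarrow> bool" where
  "decomposable k n A B f \<longleftrightarrow>
     (\<exists>s \<ge> 1. \<exists>F :: nat \<Rightarrow> (nat \<Rightarrow> 'a) \<Rightarrow> 'b.
        (\<forall>j \<in> {1..s}. F j \<in> tuples n A \<rightarrow> carrier B \<and> essential_arity n A (F j) \<le> k) \<and>
        (\<forall>x \<in> tuples n A. f x = finprod B (\<lambda>j. F j x) {1..s}))"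

end

theory Submission
  imports Defs
begin

text \<open>
  Anchor at a constant tuple with value \<open>a\<^sub>0\<close>, and for a set \<open>T\<close> of coordinates let \<open>D\<^sub>T f\<close> be the
  iterated difference of \<open>f\<close> that switches the coordinates in \<open>T\<close> from \<open>a\<^sub>0\<close> to \<open>x\<close>. Then
  \<open>f = \<Sum>\<^sub>T D\<^sub>T f\<close>, and \<open>D\<^sub>T f\<close> only depends on the coordinates in \<open>T\<close>. Since \<open>f\<close> is
  determined by \<open>oddsupp\<close>, switching two coordinates to the same value \<open>a\<close> cancels, so the
  differences satisfy \<open>\<Delta>\<^sub>a\<^sup>2 = - 2 \<Delta>\<^sub>a\<close>, while the difference in direction \<open>a\<^sub>0\<close> vanishes. By the
  pigeonhole principle \<open>D\<^sub>T f\<close> takes values in \<open>2\<^sup>r B\<close> as soon as \<open>|T| \<ge> |A| - 1 + r\<close>;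
  for \<open>r = e\<close> this is the trivial subgroup, so only sets with \<open>|T| \<le> |A| + e - 2\<close> contribute.
\<close>

section \<open>Iterated differences in an abelian group\<close>

context comm_group
begin

text \<open>This is the inclusion-exclusion form of the iterated difference, with \<open>U\<close>
  the set of coordinates already moved from the anchor \<open>y\<close> to \<open>x\<close>. The
  anchor is arbitrary because the inductions below move it one coordinate at a time.\<close>

definition mixed_difference :: "(('i \<Rightarrow> 'c) \<Rightarrow> 'a) \<Rightarrow> 'i set \<Rightarrow> ('i \<Rightarrow> 'c) \<Rightarrow> ('i \<Rightarrow> 'c) \<Rightarrow> 'a" where
  "mixed_difference f T x y =
     (\<Otimes>U\<in>Pow T. if even (card (T - U)) then f (override_on y x U) else inv f (override_on y x U))"

lemma mixed_difference_closed [simp]: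
  assumes "\<And>z. f z \<in> carrier G"
  shows "mixed_difference f T x y \<in> carrier G"
  unfolding mixed_difference_def using assms by (intro finprod_closed) auto

lemma mixed_difference_cong:
  assumes "\<And>z. f z \<in> carrier G" and "\<And>i. i \<in> T \<Longrightarrow> x i = x' i"
  shows "mixed_difference f T x y = mixed_difference f T x' y"
proof -
  have "override_on y x U = override_on y x' U" if "U \<in> Pow T" for U
    using that assms(2) by (auto simp: override_on_def fun_eq_iff)
  then show ?thesis
    unfolding mixed_difference_def using assms(1) by (intro finprod_cong') auto
qed

lemma finprod_inv:
  assumes "h \<in> I \<rightarrow> carrier G"
  shows "(\<Otimes>i\<in>I. inv h i) = inv (\<Otimes>i\<in>I. h i)"
  using assms by (induction I rule: infinite_finite_induct) (auto simp: inv_mult Pi_iff)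

lemma finprod_Pow_insert:
  assumes "finite T" "i \<notin> T" "\<And>U. h U \<in> carrier G"
  shows "finprod G h (Pow (insert i T)) = finprod G (\<lambda>U. h (insert i U)) (Pow T) \<otimes> finprod G h (Pow T)"
proof -
  have inj: "inj_on (insert i) (Pow T)"
    using assms(2) by (intro inj_onI) (metis PowD insert_ident subsetD)
  have "finprod G h (Pow (insert i T)) = finprod G h (Pow T) \<otimes> finprod G h (insert i ` Pow T)"
    unfolding Pow_insert using assms by (intro finprod_Un_disjoint) auto
  also have "finprod G h (insert i ` Pow T) = finprod G (\<lambda>U. h (insert i U)) (Pow T)"
    using assms inj by (intro finprod_reindex) auto
  finally show ?thesis
    using assms by (simp add: m_comm)
qed

text \<open>Split the subsets of \<open>insert i T\<close> by membership of \<open>i\<close>: those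
  with \<open>i\<close> keep their sign and see an anchor already moved at \<open>i\<close>, the
  others change sign.\<close>

lemma mixed_difference_insert:
  assumes f: "\<And>z. f z \<in> carrier G" and T: "finite T" "i \<notin> T"
  shows "mixed_difference f (insert i T) x y =
    mixed_difference f T x (y(i := x i)) \<otimes> inv mixed_difference f T x y"
proof -
  define h where "h T U = (if even (card (T - U)) then f (override_on y x U) else inv f (override_on y x U))"
    for T U
  define h' where "h' U = (if even (card (T - U)) then f (override_on (y(i := x i)) x U)
    else inv f (override_on (y(i := x i)) x U))" for U
  have closed: "h T U \<in> carrier G" "h' U \<in> carrier G" for T U
    using f by (auto simp: h_def h'_def)
  have "h (insert i T) (insert i U) = h' U" if "U \<in> Pow T" for U
  proof -
    have "insert i T - insert i U = T - U" using T by auto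
    moreover have "override_on y x (insert i U) = override_on (y(i := x i)) x U"
      by (auto simp: override_on_def)
    ultimately show ?thesis by (simp add: h_def h'_def)
  qed
  then have 1: "finprod G (\<lambda>U. h (insert i T) (insert i U)) (Pow T) = finprod G h' (Pow T)"
    using closed by (intro finprod_cong') auto
  have "h (insert i T) U = inv h T U" if "U \<in> Pow T" for U
  proof -
    have "insert i T - U = insert i (T - U)" "i \<notin> T - U" "finite (T - U)" using T that by auto
    then have "even (card (insert i T - U)) \<longleftrightarrow> odd (card (T - U))" by simp
    then show ?thesis using f by (simp add: h_def)
  qed
  then have "finprod G (h (insert i T)) (Pow T) = finprod G (\<lambda>U. inv h T U) (Pow T)"
    using closed by (intro finprod_cong') auto
  also have "\<dots> = inv finprod G (h T) (Pow T)"
    using closed by (intro finprod_inv) auto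
  finally have 2: "finprod G (h (insert i T)) (Pow T) = inv finprod G (h T) (Pow T)" .
  have "finprod G (h (insert i T)) (Pow (insert i T)) = finprod G h' (Pow T) \<otimes> inv finprod G (h T) (Pow T)"
    using finprod_Pow_insert[of T i "h (insert i T)"] T closed 1 2 by simp
  then show ?thesis
    unfolding mixed_difference_def h_def h'_def .
qed

text \<open>Moebius inversion over subsets. When \<open>i\<close> joins \<open>J\<close>, the terms
  for \<open>T\<close> and \<open>insert i T\<close> telescope to the term for \<open>T\<close> at
  the anchor moved at \<open>i\<close>, so the induction must generalise over
  \<open>y\<close>.\<close>

lemma override_on_eq_finprod_mixed_difference:
  assumes f: "\<And>z. f z \<in> carrier G" and "finite J"
  shows "f (override_on y x J) = (\<Otimes>T\<in>Pow J. mixed_difference f T x y)"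
  using \<open>finite J\<close>
proof (induction J arbitrary: y rule: finite_induct)
  case empty
  show ?case using f by (simp add: mixed_difference_def)
next
  case (insert i J)
  let ?y = "y(i := x i)" and ?D = "mixed_difference f"
  have "(\<Otimes>T\<in>Pow (insert i J). ?D T x y) =
      (\<Otimes>T\<in>Pow J. ?D (insert i T) x y) \<otimes> (\<Otimes>T\<in>Pow J. ?D T x y)"
    using insert.hyps f by (intro finprod_Pow_insert) auto
  also have "\<dots> = (\<Otimes>T\<in>Pow J. ?D (insert i T) x y \<otimes> ?D T x y)"
    using f by (simp add: finprod_multf)
  also have "\<dots> = (\<Otimes>T\<in>Pow J. ?D T x ?y)"
  proof (intro finprod_cong')
    fix T assume "T \<in> Pow J"
    then have "finite T" "i \<notin> T" using insert.hyps finite_subset by auto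
    then show "?D (insert i T) x y \<otimes> ?D T x y = ?D T x ?y"
      using f by (simp add: mixed_difference_insert m_assoc)
  qed (use f in auto)
  also have "\<dots> = f (override_on ?y x J)"
    by (rule insert.IH[symmetric])
  also have "override_on ?y x J = override_on y x (insert i J)"
    by (auto simp: override_on_def)
  finally show ?case by simp
qed

text \<open>Of the four values of the \<open>T\<close>-difference, with the anchor at
  \<open>i\<close> and \<open>j\<close> equal to \<open>c\<close> or \<open>d\<close>, the two with
  equal entries agree (\<open>p\<close>) and the two with distinct positions agree
  (\<open>q\<close>). Additively, the second difference is (p - q) - (q - p) = -2(q - p).\<close>

lemma mixed_difference_insert_twice:
  assumes f: "\<And>z. f z \<in> carrier G"
    and flip: "\<And>z a b. f (z(i := a, j := a)) = f (z(i := b, j := b))"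
    and swap: "\<And>z a b. f (z(i := a, j := b)) = f (z(i := b, j := a))"
    and T: "finite T" "i \<notin> T" "j \<notin> T" "i \<noteq> j"
    and x: "x i = c" "x j = c" and y: "y i = d" "y j = d"
  shows "mixed_difference f (insert i (insert j T)) x y =
    inv (mixed_difference f (insert j T) x y [^] (2::nat))"
proof -
  let ?D = "mixed_difference f T x"
  \<comment> \<open>As \<open>U\<close> avoids \<open>i\<close> and \<open>j\<close>,
    \<open>flip\<close> and \<open>swap\<close> pass termwise from \<open>f\<close> to its
    difference.\<close>
  have upd: "override_on (y(i := a, j := b)) x U = (override_on y x U)(i := a, j := b)"
    if "U \<in> Pow T" for a b U
    using that T by (auto simp: override_on_def fun_eq_iff)
  have D_cong: "?D (y(i := a, j := b)) = ?D (y(i := c, j := d))"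
    if "\<And>z. f (z(i := a, j := b)) = f (z(i := c, j := d))" for a b c d
    unfolding mixed_difference_def using f
    by (intro finprod_cong') (auto simp: upd that)
  define p where "p = ?D y"
  define q where "q = ?D (y(j := c))"
  have [simp]: "p \<in> carrier G" "q \<in> carrier G" using f by (auto simp: p_def q_def)
  have q': "?D (y(i := c)) = q"
  proof -
    have "y(i := c, j := d) = y(i := c)" "y(i := d, j := c) = y(j := c)"
      using y T by (auto simp: fun_eq_iff)
    moreover have "?D (y(i := c, j := d)) = ?D (y(i := d, j := c))"
      by (rule D_cong) (rule swap)
    ultimately show ?thesis by (simp only: q_def)
  qed
  have p': "?D (y(i := c, j := c)) = p"
  proof -
    have "y(i := d, j := d) = y"
      using y by (simp add: fun_eq_iff)
    moreover have "?D (y(i := c, j := c)) = ?D (y(i := d, j := d))"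
      by (rule D_cong) (rule flip)
    ultimately show ?thesis by (simp only: p_def)
  qed
  have "mixed_difference f (insert j T) x y = q \<otimes> inv p"
    using mixed_difference_insert[where f = f and T = T and i = j and x = x and y = y] f T x
    by (simp add: p_def q_def)
  moreover have "mixed_difference f (insert j T) x (y(i := c)) = p \<otimes> inv q"
    using mixed_difference_insert[where f = f and T = T and i = j and x = x and y = "y(i := c)"]
      f T x p' q' by simp
  moreover have "mixed_difference f (insert i (insert j T)) x y =
      mixed_difference f (insert j T) x (y(i := c)) \<otimes> inv mixed_difference f (insert j T) x y"
    using mixed_difference_insert[where f = f and T = "insert j T" and i = i and x = x and y = y]
      f T x by simp
  ultimately show ?thesis
    by (simp add: inv_mult numeral_2_eq_2 m_ac)
qed

text \<open>Each induction step removes one of two coordinates of \<open>T\<close> on which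
  \<open>x\<close> takes the same value, and gains one factor 2.\<close>

lemma mixed_difference_power_of_two:
  assumes f: "\<And>z. f z \<in> carrier G"
    and flip: "\<And>z a b i j. i \<in> J \<Longrightarrow> j \<in> J \<Longrightarrow> i \<noteq> j \<Longrightarrow> f (z(i := a, j := a)) = f (z(i := b, j := b))"
    and swap: "\<And>z a b i j. i \<in> J \<Longrightarrow> j \<in> J \<Longrightarrow> i \<noteq> j \<Longrightarrow> f (z(i := a, j := b)) = f (z(i := b, j := a))"
    and A: "finite A" "a0 \<in> A"
    and T: "finite T" "T \<subseteq> J" "x \<in> T \<rightarrow> A" "card T \<ge> card A - 1 + r"
  shows "\<exists>b \<in> carrier G. mixed_difference f T x (\<lambda>_. a0) = b [^] (2 ^ r :: nat)"
  using T
proof (induction r arbitrary: T)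
  case 0
  then show ?case using f by (intro bexI[of _ "mixed_difference f T x (\<lambda>_. a0)"]) auto
next
  case (Suc r)
  show ?case
  proof (cases "\<exists>i \<in> T. x i = a0")
    case True
    then obtain i where i: "i \<in> T" "x i = a0" by blast
    let ?T = "T - {i}"
    \<comment> \<open>Here \<open>x\<close> agrees with the anchor at \<open>i\<close>, so moving
      coordinate \<open>i\<close> changes nothing.\<close>
    have "mixed_difference f (insert i ?T) x (\<lambda>_. a0) = \<one>"
      using mixed_difference_insert[where f = f and T = ?T and i = i and x = x and y = "\<lambda>_. a0"] Suc.prems i f
      by (simp add: fun_upd_idem)
    then show ?thesis
      using i by (intro bexI[of _ \<one>]) (auto simp: insert_absorb)
  next
    case False
    then have "x ` T \<subseteq> A - {a0}" using Suc.prems by auto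
    \<comment> \<open>Pigeonhole: \<open>card T\<close> is at least \<open>card A + r\<close>, while
      only \<open>card A - 1\<close> values other than \<open>a0\<close> are available.\<close>
    moreover have "card (A - {a0}) < card T" using Suc.prems A by simp
    ultimately have "\<not> inj_on x T"
      using A card_inj_on_le[of x T "A - {a0}"] by auto
    then obtain i j where ij: "i \<in> T" "j \<in> T" "i \<noteq> j" "x i = x j"
      by (auto simp: inj_on_def)
    let ?T = "T - {i, j}"
    have eqs: "insert j ?T = T - {i}" "insert i (T - {i}) = T" using ij by auto
    have "card (T - {i}) \<ge> card A - 1 + r" using Suc.prems ij by simp
    then obtain b where b: "b \<in> carrier G" "mixed_difference f (T - {i}) x (\<lambda>_. a0) = b [^] (2 ^ r :: nat)"
      using Suc.IH[of "T - {i}"] Suc.prems by auto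
    have "i \<in> J" "j \<in> J" using ij Suc.prems by auto
    then have "mixed_difference f (insert i (insert j ?T)) x (\<lambda>_. a0)
        = inv (mixed_difference f (insert j ?T) x (\<lambda>_. a0) [^] (2::nat))"
      using flip swap ij Suc.prems
      by (intro mixed_difference_insert_twice[where c = "x i" and d = a0] f) auto
    then have "mixed_difference f T x (\<lambda>_. a0) = inv ((b [^] (2 ^ r :: nat)) [^] (2::nat))"
      using b eqs by simp
    \<comment> \<open>The sign is absorbed into the witness \<open>inv b\<close>.\<close>
    also have "\<dots> = inv b [^] (2 ^ Suc r :: nat)"
      using b by (simp add: nat_pow_pow nat_pow_inv mult.commute)
    finally show ?thesis using b by blast
  qed
qed

section \<open>Exponents and decompositions\<close>

lemma pow_group_exponent:
  assumes "b \<in> carrier G"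
  shows "b [^] group_exponent G = \<one>"
  using assms by (simp add: pow_eq_id group_exponent_def)

text \<open>Enumerating \<open>I\<close> turns a sum over any finite nonempty index set, below a
  family of coordinate sets, into one over \<open>{1..s}\<close> with
  \<open>s \<ge> 1\<close>.\<close>

lemma decomposable_finprodI:
  assumes I: "finite I" "I \<noteq> {}"
    and g: "\<And>i. i \<in> I \<Longrightarrow> g i \<in> tuples n A \<rightarrow> carrier G"
    and arity: "\<And>i. i \<in> I \<Longrightarrow> essential_arity n A (g i) \<le> k"
    and f: "\<And>x. x \<in> tuples n A \<Longrightarrow> f x = (\<Otimes>i\<in>I. g i x)"
  shows "decomposable k n A G f"
proof -
  obtain h where h: "bij_betw h {1..card I} I"
    using I ex_bij_betw_nat_finite_1 by blast
  have hI: "h j \<in> I" if "j \<in> {1..card I}" for j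
    using h that by (auto simp: bij_betw_def)
  have "f x = (\<Otimes>j\<in>{1..card I}. g (h j) x)" if x: "x \<in> tuples n A" for x
  proof -
    have "(\<lambda>i. g i x) \<in> h ` {1..card I} \<rightarrow> carrier G"
      using g x hI by (auto simp: Pi_iff)
    then have "finprod G (\<lambda>i. g i x) (h ` {1..card I}) = (\<Otimes>j\<in>{1..card I}. g (h j) x)"
      using h by (intro finprod_reindex) (auto simp: bij_betw_def)
    then show ?thesis using f x h by (simp add: bij_betw_def)
  qed
  moreover have "card I \<ge> 1" using I by (simp add: Suc_le_eq card_gt_0_iff)
  ultimately show ?thesis
    unfolding decomposable_def using g arity hI
    by (intro exI[of _ "card I"] conjI exI[of _ "\<lambda>j. g (h j)"]) auto
qed

end

section \<open>Parity of fibres and essential arity\<close>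

lemma oddsupp_cong:
  assumes "\<And>j. j \<in> {1..n} \<Longrightarrow> x j = y j"
  shows "oddsupp n A x = oddsupp n A y"
proof -
  have "{j \<in> {1..n}. x j = a} = {j \<in> {1..n}. y j = a}" for a
    using assms by auto
  then show ?thesis by (simp add: oddsupp_def)
qed

text \<open>Isolating the contribution of \<open>i\<close> and \<open>j\<close> reduces the two
  invariances of \<open>oddsupp\<close> below to arithmetic: equal entries contribute 0 or 2, and
  swapped entries the same sum.\<close>

lemma card_fibre_fun_upd2:
  fixes n :: nat
  assumes "i \<in> {1..n}" "j \<in> {1..n}" "i \<noteq> j"
  shows "card {k \<in> {1..n}. (z(i := a, j := b)) k = c} =
    card {k \<in> {1..n} - {i, j}. z k = c} + of_bool (a = c) + of_bool (b = c)"
proof -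
  have "{k \<in> {1..n}. (z(i := a, j := b)) k = c} =
      {k \<in> {1..n} - {i, j}. z k = c} \<union> ((if a = c then {i} else {}) \<union> (if b = c then {j} else {}))"
    using assms by auto
  moreover have "card ({k \<in> {1..n} - {i, j}. z k = c} \<union> ((if a = c then {i} else {}) \<union> (if b = c then {j} else {}))) =
      card {k \<in> {1..n} - {i, j}. z k = c} +
      card ((if a = c then {i} else {}) \<union> (if b = c then {j} else {}))"
    by (rule card_Un_disjoint) auto
  moreover have "card ((if a = c then {i} else {}) \<union> (if b = c then {j} else {})) =
      of_bool (a = c) + of_bool (b = c)"
    using assms by simp
  ultimately show ?thesis by simp
qed

lemma oddsupp_flip_pair:
  assumes "i \<in> {1..n}" "j \<in> {1..n}" "i \<noteq> j"
  shows "oddsupp n A (z(i := a, j := a)) = oddsupp n A (z(i := b, j := b))"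
  unfolding oddsupp_def card_fibre_fun_upd2[OF assms] by auto

lemma oddsupp_swap_pair:
  assumes "i \<in> {1..n}" "j \<in> {1..n}" "i \<noteq> j"
  shows "oddsupp n A (z(i := a, j := b)) = oddsupp n A (z(i := b, j := a))"
  unfolding oddsupp_def card_fibre_fun_upd2[OF assms] by (simp add: ac_simps)

text \<open>Tuples that differ only at some \<open>i\<close> outside \<open>T\<close> agree on
  \<open>T\<close>, so such an \<open>i\<close> cannot be essential.\<close>

lemma essential_arity_le_card:
  assumes "finite T" and "\<And>x y. (\<And>j. j \<in> T \<Longrightarrow> x j = y j) \<Longrightarrow> g x = g y" and "T \<subseteq> {1..n}"
  shows "essential_arity n A g \<le> card T"
proof -
  have "i \<in> T" if "essential n A g i" for i
  proof (rule ccontr)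
    assume "i \<notin> T"
    from that obtain x y where "\<forall>j \<in> {1..n} - {i}. x j = y j" "g x \<noteq> g y"
      by (auto simp: essential_def)
    moreover have "x j = y j" if "j \<in> T" for j
      using calculation(1) that \<open>i \<notin> T\<close> assms(3) by blast
    ultimately show False using assms(2)[of x y] by blast
  qed
  then show ?thesis
    unfolding essential_arity_def using assms(1) by (intro card_mono) auto
qed

section \<open>Assembling the decomposition\<close>

theorem theorem3p4:
  fixes A :: "'a set" and B :: "('b, 'm) monoid_scheme"
    and e n :: nat and f :: "(nat \<Rightarrow> 'a) \<Rightarrow> 'b"
  assumes "finite A" and "card A \<ge> 2"
    and "e \<ge> 1"
    and "comm_group B" and "group_exponent B = 2 ^ e"
    and "n \<ge> 1"
    and "f \<in> tuples n A \<rightarrow> carrier B"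
    and "determined_by_oddsupp n A (carrier B) f"
  shows "decomposable (card A + e - 2) n A B f"
proof -
  interpret comm_group B by fact
  obtain \<phi> where \<phi>: "\<phi> \<in> Pow A \<rightarrow> carrier B"
    and f: "\<And>x. x \<in> tuples n A \<Longrightarrow> f x = \<phi> (oddsupp n A x)"
    using assms(8) by (auto simp: determined_by_oddsupp_def)
  \<comment> \<open>\<open>h\<close> extends \<open>f\<close> to all functions with values in the
    carrier throughout. This matters because overriding a constant function leaves
    \<open>tuples n A\<close>.\<close>
  define h where "h x = \<phi> (oddsupp n A x)" for x
  have h: "h x \<in> carrier B" for x
    using \<phi> by (auto simp: h_def oddsupp_def Pi_iff)
  obtain a0 where a0: "a0 \<in> A" using assms(2) by fastforce
  let ?k = "card A + e - 2"
  let ?D = "\<lambda>T x. mixed_difference h T x (\<lambda>_. a0)"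
  let ?I = "{T \<in> Pow {1..n}. card T \<le> ?k}"
  show ?thesis
  proof (rule decomposable_finprodI)
    show "finite ?I" "?I \<noteq> {}" by auto
  next
    fix T assume T: "T \<in> ?I"
    then have "finite T" using finite_subset by blast
    then have "essential_arity n A (?D T) \<le> card T"
      using T h by (intro essential_arity_le_card mixed_difference_cong) auto
    then show "essential_arity n A (?D T) \<le> ?k" using T by simp
  next
    fix x assume x: "x \<in> tuples n A"
    have "?D T x = \<one>\<^bsub>B\<^esub>" if "T \<in> Pow {1..n} - ?I" for T
    proof -
      \<comment> \<open>Exceeding \<open>card A + e - 2\<close> means reaching
        \<open>card A - 1 + e\<close>; \<open>card A \<ge> 2\<close> keeps the truncated
        subtractions exact.\<close>
      have T: "T \<subseteq> {1..n}" "card T \<ge> card A - 1 + e" using that assms(2) by auto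
      moreover have "finite T" using T finite_subset by blast
      moreover have "x \<in> T \<rightarrow> A" using T x by (auto simp: tuples_def)
      ultimately obtain b where "b \<in> carrier B" "?D T x = b [^]\<^bsub>B\<^esub> (2 ^ e :: nat)"
        using mixed_difference_power_of_two[of h "{1..n}" A a0 T x e] h assms(1) a0
          oddsupp_flip_pair[of _ n _ A] oddsupp_swap_pair[of _ n _ A]
        unfolding h_def by metis
      then show ?thesis using pow_group_exponent assms(5) by metis
    qed
    then have "finprod B (\<lambda>T. ?D T x) (Pow {1..n}) = finprod B (\<lambda>T. ?D T x) ?I"
      using h by (intro finprod_mono_neutral_cong_left[symmetric]) auto
    moreover have "h (override_on (\<lambda>_. a0) x {1..n}) = finprod B (\<lambda>T. ?D T x) (Pow {1..n})"
      using h by (intro override_on_eq_finprod_mixed_difference) auto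
    \<comment> \<open>The two arguments can differ only outside \<open>{1..n}\<close>, which
      \<open>oddsupp\<close> ignores.\<close>
    moreover have "h (override_on (\<lambda>_. a0) x {1..n}) = h x"
      unfolding h_def by (intro arg_cong[of _ _ \<phi>] oddsupp_cong) simp
    ultimately show "f x = finprod B (\<lambda>T. ?D T x) ?I"
      using f x by (simp add: h_def)
  qed (use h in auto)
qed

end
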